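(* For any finite $p$-group $G$ of nilpotency class $c\le p$, one has $r(G)=\mathrm{ge}(G)$.
   Context: $\mathrm{ge}(G):=\min_S\mathrm{lcm}\{\mathrm{ord}(x)\mid x\in S\}$, with $S$ ranging over all generating subsets of $G$; $\exp(H)$ is the least common multiple of element orders of $H$. For a finite solvable group $G$, $r(G)$ is defined as follows: consider series with $G_0:=G$ and, as long as $G_{i-1}\ne\{1\}$, a nilpotent normal subgroup $N_i$ of $G_{i-1}$ and a proper subgroup $G_i<G_{i-1}$ with $N_iG_i=G_{i-1}$, with $s$ minimal such that $G_s=\{1\}$; then $r(G)$ is the minimum of $\mathrm{lcm}(\exp(N_1),\dots,\exp(N_s))$ over all such series. *)

theory Defs
  imports "HOL-Algebra.Algebra"
begin

definition commutator_subgroup :: "('a, 'b) monoid_scheme \<Rightarrow> 'a set \<Rightarrow> 'a set \<Rightarrow> 'a set" where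
  "commutator_subgroup G H K =
     generate G (\<Union>h\<in>H. \<Union>k\<in>K. {h \<otimes>\<^bsub>G\<^esub> k \<otimes>\<^bsub>G\<^esub> (inv\<^bsub>G\<^esub> h) \<otimes>\<^bsub>G\<^esub> (inv\<^bsub>G\<^esub> k)})"

text \<open>The index is shifted by one against the usual convention: \<open>lower_central G n\<close> is the term
  $\gamma_{n+1}(G)$, where $\gamma_1(G) = G$.  Hence the nilpotency class below is 0 exactly for
  the trivial group and at most 1 exactly for the abelian groups.\<close>

primrec lower_central :: "('a, 'b) monoid_scheme \<Rightarrow> nat \<Rightarrow> 'a set" where
  "lower_central G 0 = carrier G"
| "lower_central G (Suc n) = commutator_subgroup G (lower_central G n) (carrier G)"

definition nilpotent_group :: "('a, 'b) monoid_scheme \<Rightarrow> bool" where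
  "nilpotent_group G \<longleftrightarrow> group G \<and> (\<exists>n. lower_central G n = {\<one>\<^bsub>G\<^esub>})"

text \<open>Only meaningful for nilpotent groups.\<close>

definition nilpotency_class :: "('a, 'b) monoid_scheme \<Rightarrow> nat" where
  "nilpotency_class G = (LEAST n. lower_central G n = {\<one>\<^bsub>G\<^esub>})"

definition group_exp :: "('a, 'b) monoid_scheme \<Rightarrow> nat" where
  "group_exp G = Lcm (group.ord G ` carrier G)"

definition ge :: "('a, 'b) monoid_scheme \<Rightarrow> nat" where
  "ge G = (LEAST m. \<exists>S. S \<subseteq> carrier G \<and> generate G S = carrier G \<and> m = Lcm (group.ord G ` S))"

text \<open>A series is given by its length \<open>s\<close>, the subgroups \<open>Gs 0, \<dots>, Gs s\<close> and the nilpotent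
  subgroups \<open>Ns 1, \<dots>, Ns s\<close>; values at other indices are irrelevant.  The condition
  \<open>Gs i \<noteq> {\<one>}\<close> for \<open>i < s\<close> says that \<open>s\<close> is minimal with \<open>Gs s\<close> trivial.  The trivial group
  has the series with \<open>s = 0\<close>, whose least common multiple is empty, that is, 1.\<close>

definition nilpotent_supplement_series ::
    "('a, 'b) monoid_scheme \<Rightarrow> nat \<Rightarrow> (nat \<Rightarrow> 'a set) \<Rightarrow> (nat \<Rightarrow> 'a set) \<Rightarrow> bool" where
  "nilpotent_supplement_series G s Gs Ns \<longleftrightarrow>
     Gs 0 = carrier G \<and> Gs s = {\<one>\<^bsub>G\<^esub>} \<and>
     (\<forall>i<s. Gs i \<noteq> {\<one>\<^bsub>G\<^esub>} \<and>
        Ns (Suc i) \<lhd> G\<lparr>carrier := Gs i\<rparr> \<and>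
        nilpotent_group (G\<lparr>carrier := Ns (Suc i)\<rparr>) \<and>
        subgroup (Gs (Suc i)) (G\<lparr>carrier := Gs i\<rparr>) \<and>
        Gs (Suc i) \<noteq> Gs i \<and>
        Ns (Suc i) <#>\<^bsub>G\<^esub> Gs (Suc i) = Gs i)"

definition r_invariant :: "('a, 'b) monoid_scheme \<Rightarrow> nat" where
  "r_invariant G = (LEAST m. \<exists>s Gs Ns. nilpotent_supplement_series G s Gs Ns \<and>
                     m = (LCM i\<in>{1..s}. group_exp (G\<lparr>carrier := Ns i\<rparr>)))"

end

theory Submission
  imports Defs
begin

text \<open>
  The union of the \<open>N\<^sub>i\<close> of a series generates \<open>G\<close>, so \<open>ge G \<le> r G\<close>.  Conversely, let
  \<open>x\<^sub>1, \<dots>, x\<^sub>d\<close> be an irredundant generating system whose orders divide \<open>q = p ^ k\<close>; take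
  \<open>G\<^sub>i = \<langle>x\<^bsub>i+1\<^esub>, \<dots>, x\<^sub>d\<rangle>\<close> and let \<open>N\<^sub>i\<close> be the normal closure of \<open>x\<^sub>i\<close> in \<open>G\<^bsub>i-1\<^esub>\<close>.
  The normal closure of one element has smaller class than \<open>G\<close> (or is abelian), hence class less
  than \<open>p\<close>, and a group of class less than \<open>p\<close> generated by elements of order dividing \<open>q\<close> has
  exponent dividing \<open>q\<close>.

  The last fact is a form of Hall's theorem on regular \<open>p\<close>-groups.  The sequence
  \<open>(xy)\<^sup>-\<^sup>n x\<^sup>n y\<^sup>n\<close> is polynomial with respect to the lower central series, so it has a Taylor
  expansion into factors \<open>g\<^sub>j\<close> to the power \<open>n choose j\<close> with \<open>j \<ge> 2\<close> and \<open>g\<^sub>j\<close> in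
  the \<open>j\<close>-th term; at \<open>n = q\<close> every factor with \<open>j < p\<close> vanishes since \<open>q\<close> divides
  \<open>q choose j\<close>, and every other one because its base is trivial.
\<close>

section \<open>Filtrations and polynomial sequences\<close>

lemma (in group) inv_mult_cancel_left [simp]:
  "\<lbrakk>x \<in> carrier G; y \<in> carrier G\<rbrakk> \<Longrightarrow> inv x \<otimes> (x \<otimes> y) = y"
  by (simp flip: m_assoc)

lemma (in group) mult_inv_cancel_left [simp]:
  "\<lbrakk>x \<in> carrier G; y \<in> carrier G\<rbrakk> \<Longrightarrow> x \<otimes> (inv x \<otimes> y) = y"
  by (simp flip: m_assoc)

section \<open>Commutator identities\<close>

definition comm :: "('a, 'b) monoid_scheme \<Rightarrow> 'a \<Rightarrow> 'a \<Rightarrow> 'a" where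
  "comm G x y = x \<otimes>\<^bsub>G\<^esub> y \<otimes>\<^bsub>G\<^esub> inv\<^bsub>G\<^esub> x \<otimes>\<^bsub>G\<^esub> inv\<^bsub>G\<^esub> y"

context group
begin

lemma comm_closed [simp]: "\<lbrakk>x \<in> carrier G; y \<in> carrier G\<rbrakk> \<Longrightarrow> comm G x y \<in> carrier G"
  by (simp add: comm_def)

lemma comm_mult_left:
  assumes "x \<in> carrier G" "y \<in> carrier G" "z \<in> carrier G"
  shows "comm G (x \<otimes> y) z = (x \<otimes> comm G y z \<otimes> inv x) \<otimes> comm G x z"
  using assms by (simp add: comm_def m_assoc inv_mult_group)

lemma comm_mult_right:
  assumes "x \<in> carrier G" "y \<in> carrier G" "z \<in> carrier G"
  shows "comm G x (y \<otimes> z) = comm G x y \<otimes> (y \<otimes> comm G x z \<otimes> inv y)"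
  using assms by (simp add: comm_def m_assoc inv_mult_group)

lemma comm_inv_left:
  assumes "x \<in> carrier G" "z \<in> carrier G"
  shows "comm G (inv x) z = inv x \<otimes> inv (comm G x z) \<otimes> inv (inv x)"
  using assms by (simp add: comm_def m_assoc inv_mult_group)

lemma inv_comm:
  assumes "x \<in> carrier G" "y \<in> carrier G"
  shows "inv (comm G x y) = comm G y x"
  using assms by (simp add: comm_def m_assoc inv_mult_group)

lemma conj_comm:
  assumes "x \<in> carrier G" "y \<in> carrier G" "z \<in> carrier G"
  shows "z \<otimes> comm G x y \<otimes> inv z = comm G (z \<otimes> x \<otimes> inv z) (z \<otimes> y \<otimes> inv z)"
  using assms by (simp add: comm_def m_assoc inv_mult_group)

lemma conj_eq_comm_mult:
  assumes "x \<in> carrier G" "y \<in> carrier G"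
  shows "x \<otimes> y \<otimes> inv x = comm G x y \<otimes> y"
  using assms by (simp add: comm_def m_assoc)

lemma conj_pow:
  assumes "g \<in> carrier G" "x \<in> carrier G"
  shows "(g \<otimes> x \<otimes> inv g) [^] (n::nat) = g \<otimes> x [^] n \<otimes> inv g"
  using assms by (induction n) (simp_all add: m_assoc)

text \<open>By the product and inverse formulas, the \<open>x\<close> with \<open>comm G x g\<close>
  in \<open>N\<close> are closed under multiplication and inversion, provided conjugation by them
  preserves \<open>N\<close>. The set \<open>B\<close> of conjugators is a parameter because
  \<open>N\<close> may be normalised only by a subgroup such as \<open>A 0\<close>.\<close>

lemma comm_generate_left:
  assumes B: "B \<subseteq> carrier G" and T: "generate G T \<subseteq> B" and N: "subgroup N G"
    and norm: "\<And>b n. \<lbrakk>b \<in> B; n \<in> N\<rbrakk> \<Longrightarrow> b \<otimes> n \<otimes> inv b \<in> N"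
    and inv: "\<And>b. b \<in> B \<Longrightarrow> inv b \<in> B"
    and g: "g \<in> carrier G" and T_comm: "\<And>x. x \<in> T \<Longrightarrow> comm G x g \<in> N"
    and x: "x \<in> generate G T"
  shows "comm G x g \<in> N"
  using x
proof (induction x rule: generate.induct)
  case one
  then show ?case using g subgroup.one_closed[OF N] by (simp add: comm_def)
next
  case (incl h)
  then show ?case by (rule T_comm)
next
  case (inv h)
  then have "h \<in> B" using T generate.incl[of h T G] by auto
  then have "h \<in> carrier G" "inv h \<in> B" using B assms(5) by auto
  moreover have "inv (comm G h g) \<in> N"
    using T_comm[OF inv] subgroup.m_inv_closed[OF N] by blast
  ultimately show ?case
    using norm[of "inv h" "inv (comm G h g)"] g by (simp only: comm_inv_left)
next
  case (eng x y)
  then have "x \<in> B" "x \<in> carrier G" "y \<in> carrier G" using T B by auto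
  then show ?case
    using eng.IH norm[of x "comm G y g"] g subgroup.m_closed[OF N] by (simp add: comm_mult_left)
qed

end

text \<open>\<open>A 0\<close> may be smaller than the carrier, so filtrations of subgroups live in
  the ambient group. The case \<open>i = 0\<close> of \<open>comm_A\<close> makes \<open>A 0\<close>
  normalise every term.\<close>

locale filtered_group = group G for G (structure) +
  fixes A :: "nat \<Rightarrow> 'a set"
  assumes subgroup_A: "subgroup (A i) G"
    and A_Suc: "A (Suc i) \<subseteq> A i"
    and comm_A: "\<lbrakk>x \<in> A i; y \<in> A j\<rbrakk> \<Longrightarrow> comm G x y \<in> A (i + j)"
begin

lemma A_antimono: "i \<le> j \<Longrightarrow> A j \<subseteq> A i"
  using A_Suc by (rule lift_Suc_antimono_le)

lemma A_carrier: "x \<in> A i \<Longrightarrow> x \<in> carrier G"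
  using subgroup.subset[OF subgroup_A] by blast

lemma one_A: "\<one> \<in> A i"
  and mult_A: "\<lbrakk>x \<in> A i; y \<in> A i\<rbrakk> \<Longrightarrow> x \<otimes> y \<in> A i"
  and inv_A: "x \<in> A i \<Longrightarrow> inv x \<in> A i"
  using subgroup.one_closed subgroup.m_closed subgroup.m_inv_closed subgroup_A by metis+

lemma pow_A: "x \<in> A i \<Longrightarrow> x [^] (n::nat) \<in> A i"
  by (induction n) (auto simp: one_A mult_A)

lemma conj_A:
  assumes "x \<in> A 0" "y \<in> A i"
  shows "x \<otimes> y \<otimes> inv x \<in> A i"
  using comm_A[OF assms] assms by (simp add: conj_eq_comm_mult A_carrier mult_A)

text \<open>With \<open>\<sigma>\<close> the shift of sequences, iterating this construction yields the polynomial sequences.\<close>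

lemma filtered_group_diff:
  assumes hom: "\<sigma> \<in> hom G G" and closed: "\<And>i x. x \<in> A i \<Longrightarrow> \<sigma> x \<in> A i"
  shows "filtered_group G (\<lambda>m. {x \<in> A m. inv x \<otimes> \<sigma> x \<in> A (Suc m)})"
proof -
  interpret \<sigma>: group_hom G G \<sigma> by unfold_locales (fact hom)
  have A0: "x \<in> A 0" if "x \<in> A i" for x i using that A_antimono[of 0 i] by auto
  have conj': "inv y \<otimes> x \<otimes> y \<in> A i" if "y \<in> A j" "x \<in> A i" for x y i j
    using conj_A[OF A0[OF inv_A[OF that(1)]] that(2)] that(1) by (simp add: A_carrier)
  show ?thesis
  proof (intro filtered_group.intro group_axioms filtered_group_axioms.intro, goal_cases)
    case (1 i)
    show ?case
    proof (rule subgroup.intro, goal_cases)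
      case 1
      then show ?case using A_carrier by auto
    next
      case (2 x y)
      then have c: "x \<in> carrier G" "y \<in> carrier G" "\<sigma> x \<in> carrier G" "\<sigma> y \<in> carrier G"
        using A_carrier by auto
      then have "inv (x \<otimes> y) \<otimes> \<sigma> (x \<otimes> y) = (inv y \<otimes> (inv x \<otimes> \<sigma> x) \<otimes> y) \<otimes> (inv y \<otimes> \<sigma> y)"
        by (simp add: m_assoc inv_mult_group)
      with 2 show ?case using mult_A conj' by auto
    next
      case 3
      then show ?case by (simp add: one_A)
    next
      case (4 x)
      then have c: "x \<in> carrier G" "\<sigma> x \<in> carrier G" using A_carrier by auto
      then have "inv (inv x) \<otimes> \<sigma> (inv x) = inv (inv x) \<otimes> inv (inv x \<otimes> \<sigma> x) \<otimes> inv x"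
        by (simp add: m_assoc inv_mult_group)
      with 4 show ?case using conj'[of "inv x" i "inv (inv x \<otimes> \<sigma> x)" "Suc i"] inv_A by auto
    qed
  next
    case (2 i)
    then show ?case using A_Suc by auto
  next
    case (3 x i y j)
    define a b where "a = inv x \<otimes> \<sigma> x" and "b = inv y \<otimes> \<sigma> y"
    have a: "a \<in> A (Suc i)" and b: "b \<in> A (Suc j)" and x: "x \<in> A i" and y: "y \<in> A j"
      using 3 by (auto simp: a_def b_def)
    have c: "x \<in> carrier G" "y \<in> carrier G" "a \<in> carrier G" "b \<in> carrier G"
      using a b x y A_carrier by auto
    have s: "\<sigma> x = x \<otimes> a" "\<sigma> y = y \<otimes> b" using c by (simp_all add: a_def b_def)
    have yb: "y \<otimes> b \<in> A j" using y b A_Suc mult_A by blast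
    \<comment> \<open>Expanding [xa, yb] leaves [x, y] between two conjugated commutators; each
      contains \<open>a\<close> or \<open>b\<close>, which raises its degree by one.\<close>
    let ?k1 = "x \<otimes> comm G a (y \<otimes> b) \<otimes> inv x" and ?k2 = "y \<otimes> comm G x b \<otimes> inv y"
    have "\<sigma> (comm G x y) = comm G (x \<otimes> a) (y \<otimes> b)"
      using c by (simp add: comm_def s)
    also have "\<dots> = ?k1 \<otimes> (comm G x y \<otimes> ?k2)"
      using c by (simp add: comm_mult_left comm_mult_right[of x y b])
    finally have "inv (comm G x y) \<otimes> \<sigma> (comm G x y)
        = (inv (comm G x y) \<otimes> ?k1 \<otimes> comm G x y) \<otimes> ?k2"
      using c by (simp add: m_assoc)
    moreover have "?k1 \<in> A (Suc (i + j))"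
      using comm_A[OF a yb] conj_A[OF A0[OF x]] by simp
    moreover have "?k2 \<in> A (Suc (i + j))"
      using comm_A[OF x b] conj_A[OF A0[OF y]] by simp
    ultimately show ?case
      using comm_A[OF x y] conj' mult_A by auto
  qed
qed

section \<open>Polynomial sequences and their Taylor coefficients\<close>

primrec diff_seq :: "nat \<Rightarrow> nat \<Rightarrow> (nat \<Rightarrow> 'a) set" where
  "diff_seq 0 m = {f. \<forall>n. f n \<in> A m}"
| "diff_seq (Suc k) m =
     {f \<in> diff_seq k m. (\<lambda>n. inv (f n) \<otimes> f (Suc n)) \<in> diff_seq k (Suc m)}"

abbreviation seq_group :: "(nat \<Rightarrow> 'a) monoid" where
  "seq_group \<equiv> product_group UNIV (\<lambda>_. G)"

lemma group_seq_group: "group seq_group"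
  by (simp add: group_axioms)

lemma inv_seq_group: "(\<And>n. f n \<in> carrier G) \<Longrightarrow> inv\<^bsub>seq_group\<^esub> f = (\<lambda>n. inv (f n))"
  by (subst inv_product_group) (auto simp: group_axioms)

text \<open>\<open>diff_seq k\<close> constrains the iterated differences of order at most
  \<open>k\<close>, the one of order \<open>i\<close> lying in \<open>A (m + i)\<close>; that such
  sequences form a group is the Lazard-Leibman argument. Shift invariance is carried through the
  induction because \<open>filtered_group_diff\<close> asks for it.\<close>

lemma filtered_group_diff_seq:
  "filtered_group seq_group (diff_seq k) \<and> (\<forall>m. \<forall>f \<in> diff_seq k m. (\<lambda>n. f (Suc n)) \<in> diff_seq k m)"
proof (induction k)
  case 0
  have "filtered_group seq_group (diff_seq 0)"
  proof (intro filtered_group.intro group_seq_group filtered_group_axioms.intro, goal_cases)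
    case (1 i)
    have "f n \<in> carrier G" if "f \<in> diff_seq 0 i" for f n using that A_carrier by auto
    then show ?case
      by (intro subgroup.intro) (auto simp: mult_A one_A inv_A inv_seq_group)
  next
    case (2 i)
    then show ?case using A_Suc by auto
  next
    case (3 x i y j)
    then have "x n \<in> carrier G" "y n \<in> carrier G" for n using A_carrier by auto
    then show ?case using 3 comm_A by (auto simp: comm_def inv_seq_group)
  qed
  moreover have "(\<lambda>n. f (Suc n)) \<in> diff_seq 0 m" if "f \<in> diff_seq 0 m" for f m
    using that by simp
  ultimately show ?case by blast
next
  case (Suc k)
  let ?\<sigma> = "\<lambda>f::nat \<Rightarrow> 'a. \<lambda>n. f (Suc n)"
  interpret P: filtered_group seq_group "diff_seq k" using Suc by simp
  have closed: "?\<sigma> f \<in> diff_seq k m" if "f \<in> diff_seq k m" for f m using Suc that by blast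
  have hom: "?\<sigma> \<in> hom seq_group seq_group" by (auto simp: hom_def)
  have "f n \<in> carrier G" if "f \<in> diff_seq k m" for f m n
    using P.A_carrier[OF that] by (auto)
  then have eq: "diff_seq (Suc k) = (\<lambda>m. {f \<in> diff_seq k m. inv\<^bsub>seq_group\<^esub> f \<otimes>\<^bsub>seq_group\<^esub> ?\<sigma> f \<in> diff_seq k (Suc m)})"
    by (auto simp: inv_seq_group restrict_def fun_eq_iff)
  have "filtered_group seq_group (diff_seq (Suc k))"
    unfolding eq by (rule P.filtered_group_diff[OF hom closed])
  moreover have "?\<sigma> f \<in> diff_seq (Suc k) m" if "f \<in> diff_seq (Suc k) m" for f m
    using that closed[of f m] closed[of "\<lambda>n. inv (f n) \<otimes> f (Suc n)" "Suc m"] by simp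
  ultimately show ?case by blast
qed

definition poly_seq :: "nat \<Rightarrow> (nat \<Rightarrow> 'a) set" where
  "poly_seq m = (\<Inter>k. diff_seq k m)"

lemma poly_seq_range: "f \<in> poly_seq m \<Longrightarrow> f n \<in> A m"
proof -
  assume "f \<in> poly_seq m"
  then have "f \<in> diff_seq 0 m" unfolding poly_seq_def by blast
  then show ?thesis by simp
qed

lemma poly_seq_mult:
  assumes "f \<in> poly_seq m" "g \<in> poly_seq m"
  shows "(\<lambda>n. f n \<otimes> g n) \<in> poly_seq m"
proof -
  have "f \<otimes>\<^bsub>seq_group\<^esub> g \<in> diff_seq k m" for k
    using filtered_group.mult_A[of seq_group "diff_seq k"] filtered_group_diff_seq assms
    unfolding poly_seq_def by blast
  then show ?thesis by (simp add: poly_seq_def restrict_def)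
qed

lemma poly_seq_inv:
  assumes "f \<in> poly_seq m"
  shows "(\<lambda>n. inv (f n)) \<in> poly_seq m"
proof -
  have "inv\<^bsub>seq_group\<^esub> f \<in> diff_seq k m" for k
    using filtered_group.inv_A[of seq_group "diff_seq k"] filtered_group_diff_seq assms
    unfolding poly_seq_def by blast
  moreover have "f n \<in> carrier G" for n using poly_seq_range[OF assms] A_carrier by blast
  ultimately show ?thesis by (simp add: poly_seq_def inv_seq_group)
qed

lemma poly_seq_diff:
  assumes "f \<in> poly_seq m"
  shows "(\<lambda>n. inv (f n) \<otimes> f (Suc n)) \<in> poly_seq (Suc m)"
proof -
  have "f \<in> diff_seq (Suc k) m" for k using assms unfolding poly_seq_def by blast
  then show ?thesis by (simp add: poly_seq_def)
qed

text \<open>By Pascal's rule, taking the difference lowers \<open>j\<close> and raises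
  \<open>m\<close> by one, so the condition on \<open>g\<close> persists. For \<open>j = 0\<close>
  the sequence is constant and its difference trivial.\<close>

lemma binomial_pow_poly_seq:
  assumes "g \<in> A (m + j)"
  shows "(\<lambda>n. g [^] (n choose j)) \<in> poly_seq m"
proof -
  have "(\<lambda>n. g [^] (n choose j)) \<in> diff_seq k m" for k
    using assms
  proof (induction k arbitrary: m j)
    case 0
    then have "g \<in> A m" using A_antimono[of m "m + j"] by auto
    then show ?case by (simp add: pow_A)
  next
    case (Suc k)
    have g: "g \<in> carrier G" using Suc.prems A_carrier by blast
    have "(\<lambda>n. inv (g [^] (n choose j)) \<otimes> g [^] (Suc n choose j)) \<in> diff_seq k (Suc m)"
    proof (cases j)
      case 0
      have "\<one>\<^bsub>seq_group\<^esub> \<in> diff_seq k (Suc m)"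
        using filtered_group_diff_seq filtered_group.one_A by blast
      then show ?thesis using 0 g by (simp add: restrict_def)
    next
      case (Suc i)
      have "inv (g [^] (n choose j)) \<otimes> g [^] (Suc n choose j) = g [^] (n choose i)" for n
        using g by (simp add: Suc add.commute[of "n choose i"] flip: nat_pow_mult)
      then show ?thesis using Suc.IH[of "Suc m" i] Suc.prems Suc by simp
    qed
    then show ?case using Suc by simp
  qed
  then show ?thesis by (simp add: poly_seq_def)
qed

text \<open>Each differencing trades one leading trivial value for one degree. The value
  \<open>f j\<close> is the first Taylor coefficient that can be nontrivial.\<close>

lemma poly_seq_first_nontrivial:
  assumes "f \<in> poly_seq m" "\<And>i. i < j \<Longrightarrow> f i = \<one>"
  shows "f j \<in> A (m + j)"
  using assms
proof (induction j arbitrary: f m)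
  case 0
  then show ?case using poly_seq_range by simp
next
  case (Suc j)
  have "inv (f j) \<otimes> f (Suc j) \<in> A (Suc m + j)"
    using Suc.IH[OF poly_seq_diff[OF Suc.prems(1)]] Suc.prems(2) by simp
  then show ?case
    using Suc.prems poly_seq_range[OF Suc.prems(1)] A_carrier by (metis (no_types, lifting) add_Suc_shift inv_one l_one lessI)
qed

end

section \<open>Prime powers of a product\<close>

lemma prime_power_dvd_binomial:
  fixes p :: nat
  assumes "Factorial_Ring.prime p" "0 < j" "j < p"
  shows "p ^ k dvd (p ^ k choose j)"
proof -
  \<comment> \<open>In the absorption identity below, \<open>j\<close> is prime to \<open>p\<close>
    and can be cancelled.\<close>
  have "\<not> p dvd j" using assms by (auto dest: dvd_imp_le)
  then have "coprime (p ^ k) j" using assms(1) prime_imp_coprime by (metis coprime_power_left_iff)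
  moreover have "j * (p ^ k choose j) = p ^ k * (p ^ k - 1 choose (j - 1))"
    using binomial_absorption[of "j - 1" "p ^ k"] assms(2) by simp
  ultimately show ?thesis by (metis coprime_dvd_mult_right_iff dvd_triv_left)
qed

text \<open>The exponent hypothesis concerns \<open>A 2\<close> only, which suits an induction that
  controls commutators first and then passes to products in \<open>A 0\<close>.\<close>

lemma (in filtered_group) mult_pow_prime_power_eq_one:
  assumes p: "Factorial_Ring.prime p" and A01: "A 1 = A 0" and Ap: "A p = {\<one>}"
    and exp: "\<And>z. z \<in> A 2 \<Longrightarrow> z [^] (p ^ k) = \<one>"
    and x: "x \<in> A 0" "x [^] (p ^ k) = \<one>" and y: "y \<in> A 0" "y [^] (p ^ k) = \<one>"
  shows "(x \<otimes> y) [^] (p ^ k) = \<one>"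
proof (cases "k = 0")
  case True
  then show ?thesis using x y A_carrier by simp
next
  case False
  define q where "q = p ^ k"
  have pq: "p \<le> q" using False p by (simp add: q_def prime_gt_0_nat self_le_power Suc_leI)
  have p2: "p \<ge> 2" using p prime_ge_2_nat by blast
  have A_triv: "z = \<one>" if "z \<in> A j" "p \<le> j" for z j using that A_antimono[of p j] Ap by auto
  \<comment> \<open>The difference of the power sequence is constantly \<open>z\<close>; it must
    have degree 1, hence the role of \<open>A 1 = A 0\<close>.\<close>
  have lin: "(\<lambda>n. z [^] n) \<in> poly_seq 0" if "z \<in> A 0" for z
    using binomial_pow_poly_seq[of z 0 1] that A01 by simp
  define f where "f n = inv ((x \<otimes> y) [^] n) \<otimes> (x [^] n \<otimes> y [^] n)" for n :: nat
  have f: "f \<in> poly_seq 0"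
    unfolding f_def using lin[OF mult_A[OF x(1) y(1)]] lin[OF x(1)] lin[OF y(1)]
    by (intro poly_seq_mult poly_seq_inv)
  have c: "x \<in> carrier G" "y \<in> carrier G" using x y A_carrier by auto
  \<comment> \<open>The Taylor coefficients of \<open>f\<close> are removed one after the other without changing \<open>f q\<close>.\<close>
  have "\<exists>h \<in> poly_seq 0. h q = f q \<and> (\<forall>i < j. h i = \<one>)" if "2 \<le> j" "j \<le> q" for j
    using that
  proof (induction j rule: nat_induct_at_least)
    case base
    \<comment> \<open>The values at 0 and 1 are trivial, so the expansion starts in degree
      2.\<close>
    have "f i = \<one>" if "i < 2" for i using that c by (auto simp: f_def less_2_cases_iff)
    then show ?case using f by blast
  next
    case (Suc j)
    then obtain h where h: "h \<in> poly_seq 0" "h q = f q" "\<And>i. i < j \<Longrightarrow> h i = \<one>" by auto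
    define g where "g = h j"
    have g: "g \<in> A j" using poly_seq_first_nontrivial[OF h(1,3)] by (simp add: g_def)
    have gc: "g \<in> carrier G" using g A_carrier by blast
    have gq: "g [^] (q choose j) = \<one>"
    proof (cases "j < p")
      case True
      then obtain r where "q choose j = q * r"
        using prime_power_dvd_binomial[OF p, of j k] Suc.hyps by (auto simp: q_def elim: dvdE)
      moreover have "g \<in> A 2" using g A_antimono[OF Suc.hyps] by blast
      ultimately show ?thesis using exp[of g] gc by (simp add: q_def flip: nat_pow_pow)
    next
      case False
      then show ?thesis using A_triv[OF g] by simp
    qed
    \<comment> \<open>At index \<open>j\<close> the correction cancels \<open>g\<close>; at smaller
      indices its binomial exponent is 0, so trivial values stay trivial.\<close>
    define h' where "h' n = h n \<otimes> inv (g [^] (n choose j))" for n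
    have "h' \<in> poly_seq 0" unfolding h'_def
      using h(1) binomial_pow_poly_seq[of g 0 j] g by (intro poly_seq_mult poly_seq_inv) auto
    moreover have hc: "h n \<in> carrier G" for n using poly_seq_range[OF h(1)] A_carrier by blast
    then have "h' q = f q" using gq h(2) by (simp add: h'_def flip: h(2))
    moreover have "h' i = \<one>" if "i < Suc j" for i
      using that h(3) gc by (cases "i = j") (auto simp: h'_def binomial_eq_0 simp flip: g_def)
    ultimately show ?case by blast
  qed
  then obtain h where h: "h \<in> poly_seq 0" "h q = f q" "\<And>i. i < q \<Longrightarrow> h i = \<one>"
    using p2 pq by (meson le_refl order_trans)
  \<comment> \<open>What remains at \<open>q\<close> is itself a coefficient of degree
    \<open>q\<close>, and \<open>p \<le> q\<close>.\<close>
  have "f q = \<one>" using poly_seq_first_nontrivial[OF h(1), of q] h(2,3) A_triv[of _ q] pq by simp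
  then show ?thesis using x(2) y(2) c by (simp add: f_def q_def)
qed

section \<open>Exponents of groups with a short filtration\<close>

lemma (in group) conj_generate_closed:
  assumes T: "T \<subseteq> carrier G" and g: "g \<in> carrier G"
    and closed: "\<And>t. t \<in> T \<Longrightarrow> g \<otimes> t \<otimes> inv g \<in> T" and x: "x \<in> generate G T"
  shows "g \<otimes> x \<otimes> inv g \<in> generate G T"
  using x
proof (induction x rule: generate.induct)
  case one
  then show ?case using g by (simp add: generate.one)
next
  case (incl h)
  then show ?case using closed generate.incl by metis
next
  case (inv h)
  then have "h \<in> carrier G" using T by blast
  then have "g \<otimes> inv h \<otimes> inv g = inv (g \<otimes> h \<otimes> inv g)"
    using g by (simp add: inv_mult_group m_assoc)
  then show ?case using closed[OF inv] generate.inv by metis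
next
  case (eng x y)
  then have "x \<in> carrier G" "y \<in> carrier G" using generate_in_carrier[OF T] by auto
  then have "g \<otimes> (x \<otimes> y) \<otimes> inv g = (g \<otimes> x \<otimes> inv g) \<otimes> (g \<otimes> y \<otimes> inv g)"
    using g by (simp add: m_assoc)
  then show ?case using eng.IH generate.eng by metis
qed

context filtered_group
begin

lemma A_subset_A0: "x \<in> A i \<Longrightarrow> x \<in> A 0"
  using A_antimono[of 0 i] by auto

lemma generate_subset_A: "T \<subseteq> A i \<Longrightarrow> generate G T \<subseteq> A i"
  by (rule generate_subgroup_incl[OF _ subgroup_A])

text \<open>The one-sided closure lemma is applied twice: first with a generator as right argument,
  then, after swapping by inversion, with an arbitrary element of the generated subgroup
  there.\<close>

lemma comm_generate_A:
  assumes T: "T \<subseteq> A 0" and T_comm: "\<And>x y. \<lbrakk>x \<in> T; y \<in> T\<rbrakk> \<Longrightarrow> comm G x y \<in> A i"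
    and x: "x \<in> generate G T" and y: "y \<in> generate G T"
  shows "comm G x y \<in> A i"
proof -
  have gen: "generate G T \<subseteq> A 0" using T by (rule generate_subset_A)
  note left = comm_generate_left[OF subgroup.subset[OF subgroup_A] gen subgroup_A conj_A inv_A]
  have T_right: "comm G u t \<in> A i" if "t \<in> T" "u \<in> generate G T" for t u
  proof (rule left)
    show "t \<in> carrier G" using that T A_carrier by blast
  qed (use that T_comm in auto)
  have T_left: "comm G t x \<in> A i" if "t \<in> T" for t
    using T_right[OF that x] inv_A inv_comm[of x t] that x gen T A_carrier by (metis subsetD)
  have "comm G y x \<in> A i"
  proof (rule left)
    show "x \<in> carrier G" using x gen A_carrier by blast
  qed (use y T_left in auto)
  then show ?thesis
    using inv_A[of "comm G y x" i] inv_comm[of y x] gen x y A_carrier by (metis subsetD)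
qed

text \<open>Raising the filtration degree by one on \<open>K\<close> is possible because \<open>[K, K]\<close> lies one step
  deeper than its degree 2 requires; this is what shortens the filtration in the induction.\<close>

lemma filtered_group_shift:
  assumes A01: "A 1 = A 0" and K: "subgroup K G" "K \<subseteq> A 0"
    and KK: "\<And>x y. \<lbrakk>x \<in> K; y \<in> K\<rbrakk> \<Longrightarrow> comm G x y \<in> A 3"
  shows "filtered_group G (\<lambda>i. if i \<le> 1 then K else A (Suc i) \<inter> K)"
proof (intro filtered_group.intro group_axioms filtered_group_axioms.intro, goal_cases)
  case (1 i)
  then show ?case using K subgroup_A subgroups_Inter_pair by auto
next
  case (2 i)
  then show ?case using A_Suc by auto
next
  case (3 x i y j)
  note mem = 3
  then have xy: "x \<in> K" "y \<in> K" by (auto split: if_splits)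
  then have cK: "comm G x y \<in> K"
    using K(1) by (simp add: comm_def subgroup.m_closed subgroup.m_inv_closed)
  have in_A: "z \<in> A l" if "z \<in> K" "l \<le> 1" for z l
    using that K(2) A01 by (cases l) auto
  consider "i + j \<le> 1" | "i = 1" "j = 1" | "i \<le> 1" "2 \<le> j" | "2 \<le> i" "j \<le> 1" | "2 \<le> i" "2 \<le> j"
    by linarith
  then show ?case
  proof cases
    case 1
    then show ?thesis using cK by simp
  next
    \<comment> \<open>The degrees add up to 2, but the new term of index 2 is cut out of
      \<open>A 3\<close>: here \<open>comm_A\<close> is too weak and \<open>KK\<close>
      enters.\<close>
    case 2
    then show ?thesis using cK KK[OF xy] by (simp add: numeral_3_eq_3)
  next
    case 3
    then show ?thesis
      using cK comm_A[of x i y "Suc j"] in_A[OF xy(1)] mem(2) by simp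
  next
    case 4
    then show ?thesis
      using cK comm_A[of x "Suc i" y j] in_A[OF xy(2)] mem(1) by simp
  next
    case 5
    then have "comm G x y \<in> A (Suc i + Suc j)"
      using mem 5 by (intro comm_A) auto
    then have "comm G x y \<in> A (Suc (i + j))"
      using A_antimono[of "Suc (i + j)" "Suc i + Suc j"] by auto
    then show ?thesis using cK 5 by simp
  qed
qed

text \<open>In an abstract filtration \<open>A 2\<close> may be larger than the derived subgroup, whose exponent is
  the only one that the induction controls.\<close>

lemma filtered_group_restrict_derived:
  assumes D: "subgroup D G" "\<And>x y. \<lbrakk>x \<in> A 0; y \<in> A 0\<rbrakk> \<Longrightarrow> comm G x y \<in> D"
  shows "filtered_group G (\<lambda>i. if i \<le> 1 then A i else A i \<inter> D)"
proof (intro filtered_group.intro group_axioms filtered_group_axioms.intro, goal_cases)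
  case (1 i)
  then show ?case using D subgroup_A subgroups_Inter_pair by auto
next
  case (2 i)
  then show ?case using A_Suc by auto
next
  case (3 x i y j)
  then have "x \<in> A i" "y \<in> A j" by (auto split: if_splits)
  then show ?case using comm_A D(2) A_subset_A0 by auto
qed

section \<open>Normal closures of single elements\<close>

definition conjugates :: "'a \<Rightarrow> 'a set" where
  "conjugates x = (\<lambda>g. g \<otimes> x \<otimes> inv g) ` A 0"

lemma conjugates_subset: "x \<in> A 0 \<Longrightarrow> conjugates x \<subseteq> A 0"
  using conj_A by (auto simp: conjugates_def)

lemma self_in_conjugates: "x \<in> A 0 \<Longrightarrow> x \<in> conjugates x"
  unfolding conjugates_def using one_A[of 0] A_carrier[of x 0] by (intro image_eqI[of _ _ \<one>]) auto

text \<open>Conjugates of \<open>x\<close> have the form ux and vx with \<open>u\<close>,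
  \<open>v\<close> of degree 2. Since \<open>x\<close> commutes with itself, [x, vx] = [x, v], so
  every factor of [ux, vx] has degree 3.\<close>

lemma comm_conjugates:
  assumes A01: "A 1 = A 0" and x: "x \<in> A 0" and yz: "y \<in> conjugates x" "z \<in> conjugates x"
  shows "comm G y z \<in> A 3"
proof -
  obtain g h where gh: "g \<in> A 0" "h \<in> A 0" and y: "y = comm G g x \<otimes> x" and z: "z = comm G h x \<otimes> x"
    using yz x by (auto simp: conjugates_def conj_eq_comm_mult A_carrier)
  define u v where "u = comm G g x" and "v = comm G h x"
  have uv: "u \<in> A 2" "v \<in> A 2"
    using comm_A[of _ 1 x 1] gh x A01 by (auto simp: u_def v_def numeral_2_eq_2)
  then have c: "u \<in> carrier G" "v \<in> carrier G" "x \<in> carrier G" using x A_carrier by auto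
  have "v \<otimes> x \<in> A 1" using uv x A01 A_subset_A0 mult_A by auto
  then have "comm G u (v \<otimes> x) \<in> A 3" using comm_A[OF uv(1)] by fastforce
  moreover have "comm G x v \<in> A 3" using comm_A[of x 1 v 2] uv x A01 by (simp add: numeral_3_eq_3)
  then have "u \<otimes> comm G x v \<otimes> inv u \<in> A 3" using uv(1) A_subset_A0 conj_A by blast
  moreover have "comm G x (v \<otimes> x) = comm G x v"
    using c by (simp add: comm_def m_assoc inv_mult_group)
  ultimately show ?thesis
    using c mult_A by (simp add: y z comm_mult_left flip: u_def v_def)
qed

text \<open>This is the drop of the class: if \<open>A (Suc c)\<close> is trivial and
  \<open>2 \<le> c\<close>, the new filtration is already trivial at index \<open>c\<close>.\<close>

lemma filtered_group_normal_closure: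
  assumes "A 1 = A 0" "x \<in> A 0"
  shows "filtered_group G
    (\<lambda>i. if i \<le> 1 then generate G (conjugates x) else A (Suc i) \<inter> generate G (conjugates x))"
proof (rule filtered_group_shift[OF assms(1)])
  show "subgroup (generate G (conjugates x)) G"
    using conjugates_subset[OF assms(2)] A_carrier by (intro generate_is_subgroup) auto
  show "generate G (conjugates x) \<subseteq> A 0"
    by (rule generate_subset_A[OF conjugates_subset[OF assms(2)]])
  show "comm G y z \<in> A 3" if "y \<in> generate G (conjugates x)" "z \<in> generate G (conjugates x)" for y z
    using comm_generate_A[OF conjugates_subset[OF assms(2)] comm_conjugates[OF assms] that] .
qed

lemma conjugates_pow_eq_one:
  assumes "x \<in> A 0" "x [^] (q::nat) = \<one>" "y \<in> conjugates x"
  shows "y [^] q = \<one>"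
  using assms by (auto simp: conjugates_def conj_pow A_carrier)

end

text \<open>Normal closures of single elements and the derived subgroup of \<open>A 0\<close> carry
  shorter filtrations, so \<open>IH\<close> applies to both. The former bound the orders of
  commutators; these generate the derived subgroup, whose exponent is then bounded; the product
  lemma finally reaches \<open>A 0\<close>.\<close>

lemma (in filtered_group) exponent_generate_step:
  fixes p :: nat
  assumes p: "Factorial_Ring.prime p" and c: "Suc c < p"
    and IH: "\<And>A T x. \<lbrakk>filtered_group G A; A 1 = A 0; A (Suc c) = {\<one>}; generate G T = A 0;
        \<And>t. t \<in> T \<Longrightarrow> t [^] (p ^ k) = \<one>; x \<in> A 0\<rbrakk> \<Longrightarrow> x [^] (p ^ k) = \<one>"
    and A01: "A 1 = A 0" and Ac: "A (Suc (Suc c)) = {\<one>}" and T: "generate G T = A 0"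
    and T_pow: "\<And>t. t \<in> T \<Longrightarrow> t [^] (p ^ k) = \<one>" and x: "x \<in> A 0"
  shows "x [^] (p ^ k) = \<one>"
proof -
  let ?q = "p ^ k"
  have T_sub: "T \<subseteq> A 0" using T generate.incl[of _ T G] by auto
  have comm_pow: "comm G s g [^] ?q = \<one>" if s: "s \<in> A 0" "s [^] ?q = \<one>" and g: "g \<in> A 0" for s g
  proof (cases "c = 0")
    \<comment> \<open>The shift gains nothing at index 1, so this case is separate: commutators lie
      in \<open>A 2\<close>, which is trivial here.\<close>
    case True
    have "comm G s g \<in> A (1 + 1)" using s g A01 by (intro comm_A) auto
    then show ?thesis using True Ac by simp
  next
    case False
    let ?K = "generate G (conjugates s)"
    let ?C = "\<lambda>i. if i \<le> 1 then ?K else A (Suc i) \<inter> ?K"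
    have cl: "s \<in> carrier G" "g \<in> carrier G" using s g A_carrier by auto
    have "s \<in> conjugates s" "g \<otimes> s \<otimes> inv g \<in> conjugates s"
      using s g self_in_conjugates by (auto simp: conjugates_def)
    \<comment> \<open>A commutator with \<open>s\<close> is a quotient of two conjugates of
      \<open>s\<close>, hence lies in its normal closure.\<close>
    then have "s \<otimes> inv (g \<otimes> s \<otimes> inv g) \<in> ?K"
      by (intro generate.eng generate.incl generate.inv)
    moreover have "s \<otimes> inv (g \<otimes> s \<otimes> inv g) = comm G s g"
      using cl by (simp add: comm_def m_assoc inv_mult_group)
    ultimately have in_C: "comm G s g \<in> ?C 0" by simp
    show ?thesis
    proof (rule IH[where A = ?C and T = "conjugates s"])
      show "filtered_group G ?C" by (rule filtered_group_normal_closure[OF A01 s(1)])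
      show "?C (Suc c) = {\<one>}" using False Ac generate.one[of G "conjugates s"] by simp
      show "t [^] ?q = \<one>" if "t \<in> conjugates s" for t
        by (rule conjugates_pow_eq_one[OF s that])
    qed (use in_C c in simp_all)
  qed
  define T' where "T' = {comm G s g | s g t. t \<in> T \<and> s \<in> conjugates t \<and> g \<in> A 0}"
  define D where "D = generate G T'"
  have conj_sub: "s \<in> A 0" if "t \<in> T" "s \<in> conjugates t" for s t
    using conjugates_subset[of t] T_sub that by blast
  have T'2: "T' \<subseteq> A 2"
    using comm_A[of _ 1 _ 1] A01 conj_sub by (auto simp: T'_def numeral_2_eq_2)
  have T'_carrier: "T' \<subseteq> carrier G" using T'2 A_carrier by auto
  have D: "subgroup D G" unfolding D_def using T'_carrier by (rule generate_is_subgroup)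
  have D2: "D \<subseteq> A 2" unfolding D_def using T'2 by (rule generate_subset_A)
  have D_conj: "h \<otimes> d \<otimes> inv h \<in> D" if h: "h \<in> A 0" and d: "d \<in> D" for h d
    unfolding D_def
  proof (rule conj_generate_closed[OF T'_carrier])
    show "h \<in> carrier G" using h A_carrier by blast
    show "d \<in> generate G T'" using d by (simp add: D_def)
    fix y assume "y \<in> T'"
    then obtain t a g where t: "t \<in> T" "a \<in> A 0" "g \<in> A 0" "y = comm G (a \<otimes> t \<otimes> inv a) g"
      by (auto simp: T'_def conjugates_def)
    have cl: "t \<in> carrier G" "a \<in> carrier G" "g \<in> carrier G" "h \<in> carrier G"
      using t h T_sub A_carrier by auto
    then have "h \<otimes> y \<otimes> inv h
        = comm G ((h \<otimes> a) \<otimes> t \<otimes> inv (h \<otimes> a)) (h \<otimes> g \<otimes> inv h)"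
      by (simp add: t(4) conj_comm) (simp add: m_assoc inv_mult_group)
    moreover have "h \<otimes> a \<in> A 0" "h \<otimes> g \<otimes> inv h \<in> A 0" using t h mult_A conj_A by auto
    ultimately show "h \<otimes> y \<otimes> inv h \<in> T'"
      using t(1) unfolding T'_def conjugates_def by blast
  qed
  have comm_D: "comm G y g \<in> D" if y: "y \<in> A 0" and g: "g \<in> A 0" for y g
  proof (rule comm_generate_left[OF subgroup.subset[OF subgroup_A] _ D D_conj inv_A])
    show "generate G T \<subseteq> A 0" "y \<in> generate G T" using T y by auto
    show "g \<in> carrier G" using g A_carrier by blast
    fix t assume t: "t \<in> T"
    then have "t \<in> conjugates t" using T_sub self_in_conjugates by blast
    then show "comm G t g \<in> D" using t g generate.incl[of _ T' G] unfolding D_def T'_def by blast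
  qed
  have T'_pow: "t [^] ?q = \<one>" if t': "t \<in> T'" for t
  proof -
    obtain u s g where u: "u \<in> T" "s \<in> conjugates u" "g \<in> A 0" and t: "t = comm G s g"
      using t' unfolding T'_def by blast
    have "s [^] ?q = \<one>"
      using conjugates_pow_eq_one[OF _ T_pow[OF u(1)] u(2)] u(1) T_sub by blast
    then show ?thesis unfolding t using comm_pow conj_sub[OF u(1,2)] u(3) by blast
  qed
  have D_pow: "d [^] ?q = \<one>" if d: "d \<in> D" for d
  proof (cases "c = 0")
    case True
    then show ?thesis using d D2 Ac by (auto simp: numeral_2_eq_2)
  next
    case False
    let ?C = "\<lambda>i. if i \<le> 1 then D else A (Suc i) \<inter> D"
    have C: "filtered_group G ?C"
    proof (rule filtered_group_shift[OF A01 D])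
      show "D \<subseteq> A 0" using D2 A_subset_A0 by auto
      \<comment> \<open>Elements of degree 2 have commutators of degree 4, more than the shift asks
        for.\<close>
      show "comm G y z \<in> A 3" if "y \<in> D" "z \<in> D" for y z
        using comm_A[of y 2 z 2] that D2 A_antimono[of 3 4] by auto
    qed
    show ?thesis
    proof (rule IH[where A = ?C and T = T'])
      show "?C (Suc c) = {\<one>}" using False Ac subgroup.one_closed[OF D] by simp
    qed (use C d T'_pow c in \<open>simp_all add: D_def\<close>)
  qed
  \<comment> \<open>The term of index 2 now lies in \<open>D\<close>, so \<open>D_pow\<close>
    supplies the exponent hypothesis of the product lemma.\<close>
  interpret B: filtered_group G "\<lambda>i. if i \<le> 1 then A i else A i \<inter> D"
    by (rule filtered_group_restrict_derived[OF D comm_D])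
  have Bp: "A p \<inter> D = {\<one>}"
    using A_antimono[of "Suc (Suc c)" p] Ac c one_A[of p] subgroup.one_closed[OF D] by auto
  have mult_pow: "(y \<otimes> z) [^] ?q = \<one>"
    if "y \<in> A 0" "y [^] ?q = \<one>" "z \<in> A 0" "z [^] ?q = \<one>" for y z
    using B.mult_pow_prime_power_eq_one[OF p, of k y z] that D_pow A01 Bp prime_gt_1_nat[OF p] by simp
  have "x \<in> generate G T" using T x by simp
  then show ?thesis
  proof (induction x rule: generate.induct)
    case (inv h)
    then have "h \<in> carrier G" using T_sub A_carrier by blast
    then show ?case using T_pow[OF inv] by (simp add: nat_pow_inv)
  next
    case (eng y z)
    then show ?case using mult_pow[of y z] T by simp
  qed (use T_pow in simp_all)
qed

text \<open>The induction on \<open>c\<close> generalises over the filtration, since normal closures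
  and derived subgroups each bring their own.\<close>

lemma (in group) exponent_generate_short_filtration:
  fixes p :: nat
  assumes p: "Factorial_Ring.prime p" and "c < p" and "filtered_group G A"
    and "A 1 = A 0" "A (Suc c) = {\<one>}" "generate G T = A 0"
    and "\<And>t. t \<in> T \<Longrightarrow> t [^] (p ^ k) = \<one>" and "x \<in> A 0"
  shows "x [^] (p ^ k) = \<one>"
  using assms(2-)
proof (induction c arbitrary: A T x)
  case 0
  then have "x = \<one>" by auto
  then show ?case by simp
next
  case (Suc c)
  show ?case
  proof (rule filtered_group.exponent_generate_step[OF Suc.prems(2) p Suc.prems(1) _ Suc.prems(3-)])
    fix B S y
    assume "filtered_group G B" "B 1 = B 0" "B (Suc c) = {\<one>}" "generate G S = B 0"
      "\<And>t. t \<in> S \<Longrightarrow> t [^] (p ^ k) = \<one>" "y \<in> B 0"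
    then show "y [^] (p ^ k) = \<one>" using Suc.prems(1) by (intro Suc.IH[of B S y]) simp_all
  qed
qed

lemma (in filtered_group) exponent_normal_closure:
  fixes p :: nat
  assumes p: "Factorial_Ring.prime p" and A: "A 1 = A 0" "A (Suc p) = {\<one>}"
    and x: "x \<in> A 0" "x [^] (p ^ k) = \<one>" and y: "y \<in> generate G (conjugates x)"
  shows "y [^] (p ^ k) = \<one>"
proof -
  have "2 \<le> p" using p prime_ge_2_nat by blast
  let ?K = "generate G (conjugates x)"
  let ?C = "\<lambda>i. if i \<le> 1 then ?K else A (Suc i) \<inter> ?K"
  show ?thesis
  proof (rule exponent_generate_short_filtration[where A = ?C and c = "p - 1" and T = "conjugates x", OF p])
    show "filtered_group G ?C"
      by (rule filtered_group_normal_closure[OF A(1) x(1)])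
    show "t [^] (p ^ k) = \<one>" if "t \<in> conjugates x" for t
      by (rule conjugates_pow_eq_one[OF x that])
  qed (use \<open>2 \<le> p\<close> y A(2) generate.one[of G "conjugates x"] in simp_all)
qed

section \<open>Central series\<close>

context group
begin

lemma commutator_subgroup_eq:
  "commutator_subgroup G H K = generate G {comm G h k | h k. h \<in> H \<and> k \<in> K}"
  unfolding commutator_subgroup_def comm_def by (rule arg_cong[of _ _ "generate G"]) auto

lemma lower_central_normal: "lower_central G n \<lhd> G"
proof (induction n)
  case 0
  then show ?case by (simp add: normal_inv_iff subgroup_self)
next
  case (Suc n)
  interpret N: normal "lower_central G n" G by (fact Suc)
  show ?case
    unfolding lower_central.simps commutator_subgroup_eq
  proof (rule normal_generateI)
    show "{comm G h k |h k. h \<in> lower_central G n \<and> k \<in> carrier G} \<subseteq> carrier G" by auto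
    fix y g assume "y \<in> {comm G h k |h k. h \<in> lower_central G n \<and> k \<in> carrier G}" and g: "g \<in> carrier G"
    then obtain h k where hk: "h \<in> lower_central G n" "k \<in> carrier G" "y = comm G h k" by blast
    then have "g \<otimes> y \<otimes> inv g = comm G (g \<otimes> h \<otimes> inv g) (g \<otimes> k \<otimes> inv g)"
      using g by (simp add: conj_comm)
    moreover have "g \<otimes> h \<otimes> inv g \<in> lower_central G n" using g hk N.inv_op_closed2 by blast
    moreover have "g \<otimes> k \<otimes> inv g \<in> carrier G" using g hk by blast
    ultimately show "g \<otimes> y \<otimes> inv g \<in> {comm G h k |h k. h \<in> lower_central G n \<and> k \<in> carrier G}"
      by blast
  qed
qed

lemma comm_lower_central_carrier:
  "\<lbrakk>h \<in> lower_central G n; k \<in> carrier G\<rbrakk> \<Longrightarrow> comm G h k \<in> lower_central G (Suc n)"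
  unfolding lower_central.simps commutator_subgroup_eq by (intro generate.incl) blast

lemma lower_central_Suc_subset: "lower_central G (Suc n) \<subseteq> lower_central G n"
proof -
  interpret N: normal "lower_central G n" G by (rule lower_central_normal)
  have "comm G h k \<in> lower_central G n" if h: "h \<in> lower_central G n" and k: "k \<in> carrier G" for h k
  proof -
    have "comm G h k = h \<otimes> (k \<otimes> inv h \<otimes> inv k)" using h k by (simp add: comm_def m_assoc)
    then show ?thesis using N.inv_op_closed2[OF k N.m_inv_closed[OF h]] h by simp
  qed
  then show ?thesis
    unfolding lower_central.simps commutator_subgroup_eq
    by (intro generate_subgroup_incl N.subgroup_axioms) blast
qed

text \<open>This inclusion usually comes from the three subgroups lemma. Here conjugation of a
  generator [u, v] by \<open>g\<close> is computed directly and shown to change it only by an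
  element of the target term.\<close>

lemma comm_lower_central:
  assumes "g \<in> lower_central G i" "y \<in> lower_central G j"
  shows "comm G g y \<in> lower_central G (Suc (i + j))"
  using assms
proof (induction j arbitrary: i g y)
  case 0
  then show ?case using comm_lower_central_carrier[of g i y] by simp
next
  case (Suc j)
  let ?L = "lower_central G"
  define N where "N = ?L (Suc (i + Suc j))"
  interpret N: normal N G unfolding N_def by (rule lower_central_normal)
  have L_carrier: "z \<in> carrier G" if "z \<in> ?L l" for z l
    using that lower_central_normal[of l] normal_imp_subgroup subgroup.subset by blast
  have g: "g \<in> carrier G" using Suc.prems L_carrier by blast
  have "comm G (comm G u v) g \<in> N" if u: "u \<in> ?L j" and v: "v \<in> carrier G" for u v
  proof -
    interpret Lj: normal "?L j" G by (rule lower_central_normal)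
    \<comment> \<open>Conjugation by \<open>g\<close> turns \<open>u\<close> into
      \<open>\<alpha> \<otimes> u\<close> and \<open>v\<close> into
      \<open>\<beta> \<otimes> v\<close>. Modulo \<open>N\<close>, \<open>\<alpha>\<close> is
      central and \<open>\<beta>\<close> commutes with \<open>?L j\<close>.\<close>
    define y \<alpha> \<beta> where "y = comm G u v" and "\<alpha> = comm G g u" and "\<beta> = comm G g v"
    have \<alpha>: "\<alpha> \<in> ?L (Suc (i + j))" using Suc.IH[OF Suc.prems(1) u] by (simp add: \<alpha>_def)
    have \<beta>: "\<beta> \<in> ?L (Suc i)" using comm_lower_central_carrier[OF Suc.prems(1) v] by (simp add: \<beta>_def)
    have c: "u \<in> carrier G" "v \<in> carrier G" "\<alpha> \<in> carrier G" "\<beta> \<in> carrier G" "y \<in> carrier G"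
      using u v L_carrier[OF \<alpha>] L_carrier[OF \<beta>] L_carrier[OF u] by (auto simp: y_def)
    have \<alpha>_central: "comm G \<alpha> w \<in> N" if "w \<in> carrier G" for w
      using comm_lower_central_carrier[OF \<alpha> that] by (simp add: N_def)
    have \<beta>_u: "comm G \<beta> w \<in> N" if "w \<in> ?L j" for w
      using Suc.IH[OF \<beta> that] by (simp add: N_def)
    let ?w = "v \<otimes> inv u \<otimes> inv v"
    have w: "?w \<in> ?L j" using u v Lj.inv_op_closed2 by blast
    have \<beta>_y: "comm G \<beta> y \<in> N"
    proof -
      \<comment> \<open>\<open>y\<close> is \<open>u\<close> times a conjugate of its inverse; both
        factors lie in \<open>?L j\<close>.\<close>
      have "y = u \<otimes> ?w" using c(1,2) by (simp add: y_def comm_def m_assoc)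
      then have "comm G \<beta> y = comm G \<beta> u \<otimes> (u \<otimes> comm G \<beta> ?w \<otimes> inv u)"
        using c w by (simp add: comm_mult_right)
      then show ?thesis using \<beta>_u[OF u] N.inv_op_closed2[OF c(1) \<beta>_u[OF w]] by simp
    qed
    have u_\<beta>: "comm G u \<beta> \<in> N"
      using N.m_inv_closed[OF \<beta>_u[OF u]] c by (simp add: inv_comm)
    \<comment> \<open>Since \<open>\<beta>\<close> commutes with \<open>u\<close> and
      \<open>y\<close> modulo \<open>N\<close>, this commutator is congruent to
      \<open>y\<close>.\<close>
    define z where "z = comm G u (\<beta> \<otimes> v)"
    have z: "z \<in> carrier G" using c by (simp add: z_def)
    have z_eq: "z = comm G u \<beta> \<otimes> (comm G \<beta> y \<otimes> y)"
      using c by (simp add: z_def comm_mult_right flip: y_def) (simp add: conj_eq_comm_mult)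
    have "g \<otimes> y \<otimes> inv g = comm G (\<alpha> \<otimes> u) (\<beta> \<otimes> v)"
      using g c(1,2) by (simp add: y_def conj_comm) (simp add: conj_eq_comm_mult \<alpha>_def \<beta>_def)
    also have "\<dots> = (comm G \<alpha> z \<otimes> z) \<otimes> comm G \<alpha> (\<beta> \<otimes> v)"
      using c z by (simp add: comm_mult_left conj_eq_comm_mult flip: z_def)
    finally have "comm G g y = comm G \<alpha> z \<otimes> (z \<otimes> (comm G \<alpha> (\<beta> \<otimes> v) \<otimes> inv y))"
      using c g z by (simp add: comm_def[of G g y] m_assoc)
    also have "\<dots> = comm G \<alpha> z \<otimes> (comm G u \<beta> \<otimes> (comm G \<beta> y \<otimes>
        (y \<otimes> comm G \<alpha> (\<beta> \<otimes> v) \<otimes> inv y)))"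
      by (subst (2) z_eq) (use c z in \<open>simp add: m_assoc\<close>)
    finally have "comm G g y = \<dots>" .
    moreover have "y \<otimes> comm G \<alpha> (\<beta> \<otimes> v) \<otimes> inv y \<in> N"
      using c by (intro N.inv_op_closed2 \<alpha>_central) auto
    ultimately have "comm G g y \<in> N" using \<alpha>_central[OF z] u_\<beta> \<beta>_y by simp
    then show ?thesis using N.m_inv_closed[of "comm G g y"] g c by (simp add: inv_comm y_def)
  qed
  note gen = this
  have "comm G y g \<in> N"
  proof (rule comm_generate_left[where B = "carrier G" and T = "{comm G h k |h k. h \<in> ?L j \<and> k \<in> carrier G}"])
    show "y \<in> generate G {comm G h k |h k. h \<in> ?L j \<and> k \<in> carrier G}"
      using Suc.prems(2) by (simp add: commutator_subgroup_eq)
    show "generate G {comm G h k |h k. h \<in> ?L j \<and> k \<in> carrier G} \<subseteq> carrier G"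
      using L_carrier by (intro generate_incl) auto
    show "comm G x g \<in> N" if "x \<in> {comm G h k |h k. h \<in> ?L j \<and> k \<in> carrier G}" for x
      using that gen by blast
  qed (use g N.subgroup_axioms N.inv_op_closed2 in auto)
  then have "comm G g y \<in> N"
    using N.m_inv_closed[of "comm G y g"] g L_carrier[OF Suc.prems(2)] by (simp add: inv_comm)
  then show ?case unfolding N_def .
qed

text \<open>The index shift makes the terms of degree 0 and 1 both equal to the whole group.\<close>

lemma filtered_group_lower_central: "filtered_group G (\<lambda>i. lower_central G (i - 1))"
proof (intro filtered_group.intro group_axioms filtered_group_axioms.intro, goal_cases)
  case (1 i)
  then show ?case using lower_central_normal normal_imp_subgroup by blast
next
  case (2 i)
  then show ?case using lower_central_Suc_subset[of "i - 1"] by (cases i) auto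
next
  case (3 x i y j)
  have "i + j - 1 \<le> Suc ((i - 1) + (j - 1))" by simp
  then have "lower_central G (Suc ((i - 1) + (j - 1))) \<subseteq> lower_central G (i + j - 1)"
    using lower_central_Suc_subset by (rule lift_Suc_antimono_le[rotated])
  then show ?case using comm_lower_central[OF 3] by blast
qed

lemma lower_central_subgroup_subset:
  assumes H: "subgroup H G"
  shows "lower_central (G\<lparr>carrier := H\<rparr>) n \<subseteq> lower_central G n \<inter> H"
proof (induction n)
  case 0
  then show ?case using subgroup.subset[OF H] by auto
next
  case (Suc n)
  let ?H = "G\<lparr>carrier := H\<rparr>"
  let ?T = "{comm G h k | h k. h \<in> lower_central ?H n \<and> k \<in> H}"
  have comm_eq: "comm ?H h k = comm G h k" if "h \<in> H" "k \<in> H" for h k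
    using that H by (simp add: comm_def)
  have "{comm ?H h k | h k. h \<in> lower_central ?H n \<and> k \<in> carrier ?H} = ?T"
    using Suc comm_eq by (auto; metis (no_types, lifting) IntD2 subsetD)
  then have "lower_central ?H (Suc n) = generate ?H ?T"
    using group.commutator_subgroup_eq[OF subgroup_imp_group[OF H]] by simp
  also have "?T \<subseteq> H"
    using Suc H by (auto simp: comm_def subset_iff intro!: subgroup.m_closed subgroup.m_inv_closed)
  then have "generate ?H ?T = generate G ?T" using H by (rule generate_consistent)
  also have "\<dots> \<subseteq> lower_central G (Suc n)"
    unfolding lower_central.simps commutator_subgroup_eq
    using Suc subgroup.subset[OF H] by (intro mono_generate) blast
  finally have "lower_central ?H (Suc n) \<subseteq> lower_central G (Suc n)" .
  moreover have "generate G ?T \<subseteq> H" using \<open>?T \<subseteq> H\<close> H by (rule generate_subgroup_incl)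
  ultimately show ?case using \<open>lower_central ?H (Suc n) = _\<close> \<open>generate ?H ?T = _\<close> by simp
qed

lemma nilpotent_group_subgroup:
  assumes "subgroup H G" "lower_central G n = {\<one>}"
  shows "nilpotent_group (G\<lparr>carrier := H\<rparr>)"
proof -
  interpret H: group "G\<lparr>carrier := H\<rparr>" by (rule subgroup_imp_group[OF assms(1)])
  have "\<one> \<in> lower_central (G\<lparr>carrier := H\<rparr>) n"
    using subgroup.one_closed[OF normal_imp_subgroup[OF H.lower_central_normal]] by simp
  then have "lower_central (G\<lparr>carrier := H\<rparr>) n = {\<one>}"
    using lower_central_subgroup_subset[OF assms(1), of n] assms(2) by auto
  then show ?thesis unfolding nilpotent_group_def using H.group_axioms by auto
qed

section \<open>Nilpotency of finite p-groups via the upper central series\<close>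

lemma prime_power_order_center_nontrivial:
  fixes p :: nat
  assumes p: "Factorial_Ring.prime p" and ord: "order G = p ^ n" and n: "n > 0"
  shows "\<exists>z \<in> carrier G. z \<noteq> \<one> \<and> (\<forall>h \<in> carrier G. comm G z h = \<one>)"
proof (rule ccontr)
  assume no_center: "\<not> ?thesis"
  let ?\<phi> = "\<lambda>g. \<lambda>h \<in> carrier G. g \<otimes> h \<otimes> inv g"
  let ?O = "orbits G (carrier G) ?\<phi>"
  interpret \<phi>: group_action G "carrier G" ?\<phi> by (rule action_by_conjugation)
  have fin: "finite (carrier G)" using ord p by (metis order_gt_0_iff_finite prime_gt_0_nat zero_less_power)
  have fin_O: "finite ?O" using fin by (simp add: orbits_def)
  have orb_one: "orbit G ?\<phi> \<one> = {\<one>}" by (auto simp: orbit_def intro: exI[of _ \<one>])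
  \<comment> \<open>Class equation: without a nontrivial central element, every conjugacy class
    except that of the identity has a size divisible by \<open>p\<close>, which forces
    \<open>p\<close> to divide 1.\<close>
  have p_dvd: "p dvd card orb" if orb: "orb \<in> ?O - {{\<one>}}" for orb
  proof -
    obtain x where x: "x \<in> carrier G" "orb = orbit G ?\<phi> x"
      using orb unfolding orbits_def by blast
    then have "x \<noteq> \<one>" using orb orb_one by auto
    then obtain h where h: "h \<in> carrier G" "comm G x h \<noteq> \<one>" using no_center x by blast
    have "h \<otimes> x \<otimes> inv h \<noteq> x"
    proof
      assume "h \<otimes> x \<otimes> inv h = x"
      then have "comm G h x = \<one>" using h x by (simp add: comm_def)
      then show False using h x inv_comm[of h x] by simp
    qed
    moreover have "h \<otimes> x \<otimes> inv h \<in> orb" "x \<in> orb"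
      using h x \<phi>.orbit_refl[OF x(1)] by (auto simp: orbit_def)
    ultimately have "card orb \<noteq> 1" by (auto simp: card_1_singleton_iff)
    moreover have "p ^ n = card orb * card (stabilizer G ?\<phi> x)"
      unfolding x(2) ord[symmetric] by (rule \<phi>.orbit_stabilizer_theorem[OF x(1), symmetric])
    then have "card orb dvd p ^ n" by (rule dvdI)
    then obtain m where "card orb = p ^ m" using p by (auto simp: divides_primepow_nat)
    ultimately show ?thesis
      by (cases m) auto
  qed
  have "(\<Sum>orb \<in> ?O. card orb) = order G"
    using \<phi>.disjoint_sum[OF fin, of "\<lambda>_. 1::nat"] by (simp add: order_def)
  moreover have "{\<one>} \<in> ?O" using orb_one by (auto simp: orbits_def)
  ultimately have "p ^ n = 1 + (\<Sum>orb \<in> ?O - {{\<one>}}. card orb)"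
    using fin_O ord by (simp add: sum.remove)
  moreover have "p dvd (\<Sum>orb \<in> ?O - {{\<one>}}. card orb)" using p_dvd by (rule dvd_sum)
  moreover have "p dvd p ^ n" using n by simp
  ultimately have "p dvd 1" using dvd_add_left_iff[of p _ 1] by simp
  then show False using p by simp
qed

text \<open>The ascending central series, described by commutators instead of centres of quotient
  groups.\<close>

primrec upper_central :: "nat \<Rightarrow> 'a set" where
  "upper_central 0 = {\<one>}"
| "upper_central (Suc i) = {g \<in> carrier G. \<forall>h \<in> carrier G. comm G g h \<in> upper_central i}"

lemma upper_central_normal: "upper_central i \<lhd> G"
proof (induction i)
  case 0
  then show ?case by (simp add: one_is_normal)
next
  case (Suc i)
  interpret Z: normal "upper_central i" G by (fact Suc)
  show ?case
  proof (rule normal_invI)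
    show "subgroup (upper_central (Suc i)) G"
      by (rule subgroup.intro)
        (auto simp: comm_mult_left comm_inv_left comm_def[of G \<one>] intro: Z.inv_op_closed1 Z.inv_op_closed2)
    show "g \<otimes> x \<otimes> inv g \<in> upper_central (Suc i)"
      if g: "g \<in> carrier G" and x: "x \<in> upper_central (Suc i)" for g x
    proof -
      have "comm G (g \<otimes> x \<otimes> inv g) h \<in> upper_central i" if h: "h \<in> carrier G" for h
      proof -
        have "comm G (g \<otimes> x \<otimes> inv g) h = g \<otimes> comm G x (inv g \<otimes> h \<otimes> g) \<otimes> inv g"
          using g h x by (simp add: comm_def m_assoc inv_mult_group)
        then show ?thesis using g h x Z.inv_op_closed2 by simp
      qed
      then show ?thesis using g x by simp
    qed
  qed
qed

text \<open>The quotient by \<open>upper_central i\<close> is a nontrivial p-group; a nontrivial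
  central coset lifts to a new element of the next term.\<close>

lemma upper_central_psubset:
  fixes p :: nat
  assumes p: "Factorial_Ring.prime p" and ord: "order G = p ^ n"
    and ne: "upper_central i \<noteq> carrier G"
  shows "upper_central i \<subset> upper_central (Suc i)"
proof -
  let ?Z = "upper_central i"
  interpret Z: normal ?Z G by (rule upper_central_normal)
  interpret Q: group "G Mod ?Z" by (rule Z.factorgroup_is_group)
  have fin: "finite (carrier G)" using ord p by (metis order_gt_0_iff_finite prime_gt_0_nat zero_less_power)
  have lagr: "order (G Mod ?Z) * card ?Z = p ^ n"
    using lagrange[OF Z.subgroup_axioms] ord by (simp add: order_def FactGroup_def)
  then obtain m where m: "order (G Mod ?Z) = p ^ m"
    using p by (metis divides_primepow_nat dvd_triv_left)
  have "m \<noteq> 0"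
  proof
    assume "m = 0"
    then have "card ?Z = card (carrier G)" using lagr m ord by (simp add: order_def)
    then show False using ne fin Z.subset card_subset_eq by blast
  qed
  then obtain C where C: "C \<in> carrier (G Mod ?Z)" "C \<noteq> \<one>\<^bsub>G Mod ?Z\<^esub>"
      "\<And>D. D \<in> carrier (G Mod ?Z) \<Longrightarrow> comm (G Mod ?Z) C D = \<one>\<^bsub>G Mod ?Z\<^esub>"
    using Q.prime_power_order_center_nontrivial[OF p m] by auto
  then obtain z where z: "z \<in> carrier G" "C = ?Z #> z" by (auto simp: FactGroup_def RCOSETS_def)
  have "comm G z h \<in> ?Z" if h: "h \<in> carrier G" for h
  proof -
    have "?Z #> h \<in> carrier (G Mod ?Z)" using h by (auto simp: FactGroup_def RCOSETS_def)
    then have "comm (G Mod ?Z) C (?Z #> h) = ?Z" using C(3) by (simp add: FactGroup_def)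
    moreover have "comm (G Mod ?Z) C (?Z #> h) = ?Z #> comm G z h"
    proof -
      interpret \<pi>: group_hom G "G Mod ?Z" "\<lambda>a. ?Z #> a"
        by unfold_locales (rule Z.r_coset_hom_Mod)
      show ?thesis using z h by (simp add: comm_def)
    qed
    ultimately have "?Z #> comm G z h = ?Z" by simp
    then show ?thesis using z h Z.subgroup_axioms coset_join1 by (metis comm_closed Z.subset)
  qed
  then have "z \<in> upper_central (Suc i)" using z by simp
  moreover have "z \<notin> ?Z"
  proof
    assume "z \<in> ?Z"
    then have "C = ?Z" using z coset_join2 Z.subgroup_axioms by blast
    then show False using C(2) by (simp add: FactGroup_def)
  qed
  moreover have "?Z \<subseteq> upper_central (Suc i)"
  proof
    fix x assume x: "x \<in> ?Z"
    have "comm G x h \<in> ?Z" if h: "h \<in> carrier G" for h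
    proof -
      have "comm G x h = x \<otimes> (h \<otimes> inv x \<otimes> inv h)" using x h by (simp add: comm_def m_assoc)
      then show ?thesis using x h Z.inv_op_closed2[OF h Z.m_inv_closed[OF x]] by simp
    qed
    then show "x \<in> upper_central (Suc i)" using x by simp
  qed
  ultimately show ?thesis by blast
qed

lemma lower_central_subset_upper_central:
  assumes "upper_central n = carrier G" "i \<le> n"
  shows "lower_central G i \<subseteq> upper_central (n - i)"
  using assms(2)
proof (induction i)
  case 0
  then show ?case using assms(1) by simp
next
  case (Suc i)
  then have "lower_central G i \<subseteq> upper_central (Suc (n - Suc i))" by (simp add: Suc_diff_Suc)
  then show ?case
    unfolding lower_central.simps commutator_subgroup_eq
    by (intro generate_subgroup_incl normal_imp_subgroup upper_central_normal) auto
qed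

text \<open>\<open>nilpotency_class\<close> is a \<open>LEAST\<close>, so a bound on it is
  informative only once some term is known to be trivial. An upper series growing forever would
  exceed the order of \<open>G\<close>.\<close>

lemma prime_power_order_nilpotent:
  fixes p :: nat
  assumes p: "Factorial_Ring.prime p" and ord: "order G = p ^ n"
  shows "\<exists>c. lower_central G c = {\<one>}"
proof -
  have fin: "finite (carrier G)" using ord p by (metis order_gt_0_iff_finite prime_gt_0_nat zero_less_power)
  have sub: "upper_central i \<subseteq> carrier G" for i
    using upper_central_normal normal_imp_subgroup subgroup.subset by blast
  have "\<exists>c. upper_central c = carrier G"
  proof (rule ccontr)
    assume no: "\<not> ?thesis"
    have "i \<le> card (upper_central i)" for i
    proof (induction i)
      case (Suc i)
      have "card (upper_central i) < card (upper_central (Suc i))"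
        using no by (intro psubset_card_mono upper_central_psubset[OF p ord] finite_subset[OF sub fin]) auto
      then show ?case using Suc by simp
    qed simp
    then have "Suc (card (carrier G)) \<le> card (carrier G)"
      using card_mono[OF fin sub] by (meson le_trans)
    then show False by simp
  qed
  then obtain c where "upper_central c = carrier G" by blast
  then have "lower_central G c \<subseteq> {\<one>}" using lower_central_subset_upper_central[of c c] by simp
  moreover have "\<one> \<in> lower_central G c"
    using lower_central_normal normal_imp_subgroup subgroup.one_closed by blast
  ultimately show ?thesis by blast
qed

end

section \<open>Supplement series\<close>

lemma (in group) group_exp_subgroup:
  assumes "subgroup H G"
  shows "group_exp (G\<lparr>carrier := H\<rparr>) = Lcm (ord ` H)"
proof -
  interpret H: group "G\<lparr>carrier := H\<rparr>" by (rule subgroup_imp_group[OF assms])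
  have "H.ord x = ord x" for x
    unfolding H.ord_def ord_def using nat_pow_consistent[of x _ H] by simp
  then show ?thesis by (simp add: group_exp_def)
qed

text \<open>The union of the \<open>Ns\<close> competes in the minimum defining \<open>ge\<close>,
  and the lcm of its element orders is exactly the lcm of the exponents.\<close>

lemma (in group) ge_le_supplement_series:
  assumes series: "nilpotent_supplement_series G s Gs Ns"
  shows "ge G \<le> (LCM i\<in>{1..s}. group_exp (G\<lparr>carrier := Ns i\<rparr>))"
proof -
  define S where "S = (\<Union>i\<in>{1..s}. Ns i)"
  have step: "Ns (Suc i) \<lhd> G\<lparr>carrier := Gs i\<rparr>" "subgroup (Gs (Suc i)) (G\<lparr>carrier := Gs i\<rparr>)"
      "Ns (Suc i) <#> Gs (Suc i) = Gs i" if "i < s" for i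
    using series that by (auto simp: nilpotent_supplement_series_def)
  have Gs: "subgroup (Gs i) G" if "i \<le> s" for i
    using that
  proof (induction i)
    case 0
    then show ?case using series subgroup_self by (simp add: nilpotent_supplement_series_def)
  next
    case (Suc i)
    then show ?case using incl_subgroup step(2) by simp
  qed
  have Ns: "subgroup (Ns i) G" if "i \<in> {1..s}" for i
    using that incl_subgroup[OF Gs normal_imp_subgroup[OF step(1)]] by (cases i) auto
  have S: "S \<subseteq> carrier G" unfolding S_def using subgroup.subset[OF Ns] by (rule UN_least)
  \<comment> \<open>Downward induction from the trivial subgroup \<open>Gs s\<close>, using the
    product decomposition of each \<open>Gs i\<close>.\<close>
  have "Gs 0 \<subseteq> generate G S"
  proof (rule inc_induct[of 0 s "\<lambda>i. Gs i \<subseteq> generate G S"])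
    show "Gs s \<subseteq> generate G S"
      using series generate.one[of G S] by (simp add: nilpotent_supplement_series_def)
    fix i assume i: "i < s" and IH: "Gs (Suc i) \<subseteq> generate G S"
    have "Ns (Suc i) \<subseteq> S" unfolding S_def using i by (intro UN_upper) simp
    then have "Ns (Suc i) \<subseteq> generate G S" using generate.incl[of _ S G] by blast
    then show "Gs i \<subseteq> generate G S"
      unfolding step(3)[OF i, symmetric] set_mult_def using IH generate.eng[of _ G S] by blast
  qed simp
  then have "generate G S = carrier G"
    using generate_incl[OF S] series by (simp add: nilpotent_supplement_series_def subset_antisym)
  moreover have "(LCM i\<in>{1..s}. group_exp (G\<lparr>carrier := Ns i\<rparr>)) = Lcm (ord ` S)"
  proof -
    have "(LCM i\<in>{1..s}. group_exp (G\<lparr>carrier := Ns i\<rparr>)) = (LCM i\<in>{1..s}. Lcm (ord ` Ns i))"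
      by (intro arg_cong[of _ _ Lcm] image_cong refl group_exp_subgroup Ns)
    also have "\<dots> = Lcm (ord ` S)"
    proof (rule dvd_antisym)
      show "(LCM i\<in>{1..s}. Lcm (ord ` Ns i)) dvd Lcm (ord ` S)"
      proof (rule Lcm_least)
        fix m assume "m \<in> (\<lambda>i. Lcm (ord ` Ns i)) ` {1..s}"
        then obtain i where i: "i \<in> {1..s}" "m = Lcm (ord ` Ns i)" by blast
        have "Ns i \<subseteq> S" unfolding S_def using i(1) by blast
        then show "m dvd Lcm (ord ` S)" unfolding i(2) by (intro Lcm_subset image_mono)
      qed
      show "Lcm (ord ` S) dvd (LCM i\<in>{1..s}. Lcm (ord ` Ns i))"
      proof (rule Lcm_least)
        fix m assume "m \<in> ord ` S"
        then obtain i where i: "i \<in> {1..s}" "m \<in> ord ` Ns i" by (auto simp: S_def)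
        then have "m dvd Lcm (ord ` Ns i)" by simp
        also have "\<dots> dvd (LCM i\<in>{1..s}. Lcm (ord ` Ns i))" using i(1) by (intro dvd_Lcm) blast
        finally show "m dvd (LCM i\<in>{1..s}. Lcm (ord ` Ns i))" .
      qed
    qed
    finally show ?thesis .
  qed
  ultimately show ?thesis
    unfolding ge_def using S by (intro Least_le) blast
qed

section \<open>Supplement series from an irredundant generating list\<close>

definition (in group) series_group :: "'a list \<Rightarrow> nat \<Rightarrow> 'a set" where
  "series_group xs i = generate G (set (drop i xs))"

text \<open>The normal subgroups are numbered from 1 and list entries from 0: this is the normal
  closure of entry \<open>i - 1\<close> in the preceding subgroup.\<close>

definition (in group) series_normal :: "'a list \<Rightarrow> nat \<Rightarrow> 'a set" where
  "series_normal xs i =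
     generate G ((\<lambda>h. h \<otimes> xs ! (i - 1) \<otimes> inv h) ` series_group xs (i - 1))"

text \<open>Irredundancy keeps each leading entry out of the next subgroup, which makes the
  inclusion proper and the larger subgroup nontrivial.\<close>

lemma (in group) supplement_series_of_generators:
  assumes xs: "set xs \<subseteq> carrier G" "distinct xs" and gen: "generate G (set xs) = carrier G"
    and irred: "\<And>x. x \<in> set xs \<Longrightarrow> x \<notin> generate G (set xs - {x})"
    and nil: "lower_central G c = {\<one>}"
  shows "nilpotent_supplement_series G (length xs) (series_group xs) (series_normal xs)"
proof -
  have drop: "set (drop i xs) \<subseteq> carrier G" for i using xs(1) set_drop_subset by fastforce
  have Gs: "subgroup (series_group xs i) G" for i
    unfolding series_group_def using drop by (rule generate_is_subgroup)
  show ?thesis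
    unfolding nilpotent_supplement_series_def
  proof (intro conjI allI impI)
    show "series_group xs 0 = carrier G" using gen by (simp add: series_group_def)
    show "series_group xs (length xs) = {\<one>}"
      using generate_empty by (simp add: series_group_def)
    fix i assume i: "i < length xs"
    let ?K = "series_group xs i" and ?H = "series_group xs (Suc i)" and ?N = "series_normal xs (Suc i)"
    define x where "x = xs ! i"
    define T where "T = (\<lambda>h. h \<otimes> x \<otimes> inv h) ` ?K"
    have N: "?N = generate G T" by (simp add: series_normal_def T_def x_def)
    have drop_i: "set (drop i xs) = insert x (set (drop (Suc i) xs))"
      using i by (simp add: x_def flip: Cons_nth_drop_Suc)
    have xK: "x \<in> ?K" unfolding series_group_def drop_i by (intro generate.incl) simp
    have HK: "?H \<subseteq> ?K" unfolding series_group_def drop_i by (intro mono_generate) blast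
    \<comment> \<open>Distinctness puts the tail of the list inside \<open>set xs - {x}\<close>,
      where irredundancy applies.\<close>
    have "x \<notin> set (drop (Suc i) xs)"
      using xs(2) i unfolding x_def by (metis Cons_nth_drop_Suc distinct.simps(2) distinct_drop)
    then have "?H \<subseteq> generate G (set xs - {x})"
      unfolding series_group_def using set_drop_subset[of "Suc i" xs] by (intro mono_generate) blast
    then have xH: "x \<notin> ?H" using irred[of x] i by (auto simp: x_def)
    then show "?K \<noteq> {\<one>}" "?H \<noteq> ?K" using xK subgroup.one_closed[OF Gs] by auto
    have TK: "T \<subseteq> ?K"
      using xK Gs by (auto simp: T_def intro!: subgroup.m_closed[OF Gs] subgroup.m_inv_closed[OF Gs])
    have T: "T \<subseteq> carrier G" using TK subgroup.subset[OF Gs] by blast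
    have NK: "?N \<subseteq> ?K" unfolding N using TK Gs by (rule generate_subgroup_incl)
    have subN: "subgroup ?N G" unfolding N using T by (rule generate_is_subgroup)
    interpret K: group "G\<lparr>carrier := ?K\<rparr>" by (rule subgroup_imp_group[OF Gs])
    show norm: "?N \<lhd> G\<lparr>carrier := ?K\<rparr>"
    proof (rule K.normal_invI)
      show "subgroup ?N (G\<lparr>carrier := ?K\<rparr>)" using subN Gs NK by (rule subgroup_incl)
      fix g n assume g: "g \<in> carrier (G\<lparr>carrier := ?K\<rparr>)" and n: "n \<in> ?N"
      have "g \<otimes> n \<otimes> inv g \<in> ?N"
        unfolding N
      proof (rule conj_generate_closed[OF T])
        show "g \<in> carrier G" using g subgroup.subset[OF Gs] by auto
        show "n \<in> generate G T" using n N by simp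
        fix t assume "t \<in> T"
        then obtain h where h: "h \<in> ?K" "t = h \<otimes> x \<otimes> inv h" by (auto simp: T_def)
        have "g \<in> carrier G" "h \<in> carrier G" "x \<in> carrier G"
          using g h xK subgroup.subset[OF Gs] by auto
        then have "g \<otimes> t \<otimes> inv g = (g \<otimes> h) \<otimes> x \<otimes> inv (g \<otimes> h)"
          by (simp add: h(2) m_assoc inv_mult_group)
        moreover have "g \<otimes> h \<in> ?K" using g h(1) subgroup.m_closed[OF Gs] by simp
        ultimately show "g \<otimes> t \<otimes> inv g \<in> T" unfolding T_def by blast
      qed
      then show "g \<otimes>\<^bsub>G\<lparr>carrier := ?K\<rparr>\<^esub> n \<otimes>\<^bsub>G\<lparr>carrier := ?K\<rparr>\<^esub> inv\<^bsub>G\<lparr>carrier := ?K\<rparr>\<^esub> g \<in> ?N"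
        using g Gs by simp
    qed
    show "nilpotent_group (G\<lparr>carrier := ?N\<rparr>)" using subN nil by (rule nilpotent_group_subgroup)
    show subH: "subgroup ?H (G\<lparr>carrier := ?K\<rparr>)" using Gs Gs HK by (rule subgroup_incl)
    show "?N <#> ?H = ?K"
    proof
      show "?N <#> ?H \<subseteq> ?K"
        unfolding set_mult_def using NK HK subgroup.m_closed[OF Gs[of i]] by blast
      \<comment> \<open>Normality makes the product a subgroup, so it suffices that it contains the
        generators of \<open>?K\<close>.\<close>
      have "subgroup (?N <#> ?H) G"
        using incl_subgroup[OF Gs mult_norm_sub_in_sub[OF norm subH Gs]] .
      moreover have "set (drop i xs) \<subseteq> ?N <#> ?H"
      proof -
        have "x \<in> T"
          unfolding T_def using subgroup.one_closed[OF Gs] subgroup.mem_carrier[OF Gs xK]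
          by (intro image_eqI[of _ _ \<one>]) simp_all
        then have "x \<in> ?N" unfolding N by (rule generate.incl)
        then have "x \<otimes> \<one> \<in> ?N <#> ?H" using subgroup.one_closed[OF Gs] unfolding set_mult_def by blast
        moreover have "\<one> \<otimes> y \<in> ?N <#> ?H" if "y \<in> set (drop (Suc i) xs)" for y
          using that subgroup.one_closed[OF subN] generate.incl[of y]
          unfolding set_mult_def series_group_def by blast
        ultimately show ?thesis
          using drop_i drop[of "Suc i"] subgroup.mem_carrier[OF Gs xK] by (auto simp: subset_iff)
      qed
      ultimately show "?K \<subseteq> ?N <#> ?H"
        by (subst series_group_def) (rule generate_subgroup_incl)
    qed
  qed
qed

text \<open>A generating subset of least cardinality works: a redundant element could be
  dropped.\<close>

lemma (in group) exists_irredundant_generators: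
  assumes "finite S" "S \<subseteq> carrier G"
  shows "\<exists>T \<subseteq> S. generate G T = generate G S \<and> (\<forall>x \<in> T. x \<notin> generate G (T - {x}))"
proof -
  define P where "P T \<longleftrightarrow> T \<subseteq> S \<and> generate G T = generate G S" for T
  have "P S" by (simp add: P_def)
  then obtain T where T: "P T" "\<And>U. P U \<Longrightarrow> card T \<le> card U"
    using ex_has_least_nat[of P S card] by blast
  have TS: "T \<subseteq> S" using T(1) by (simp add: P_def)
  have "x \<notin> generate G (T - {x})" if x: "x \<in> T" for x
  proof
    assume "x \<in> generate G (T - {x})"
    then have "T \<subseteq> generate G (T - {x})" using generate.incl[of _ "T - {x}" G] by blast
    moreover have "subgroup (generate G (T - {x})) G"
      using TS \<open>S \<subseteq> carrier G\<close> by (intro generate_is_subgroup) blast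
    ultimately have "generate G T \<subseteq> generate G (T - {x})" by (rule generate_subgroup_incl)
    then have "P (T - {x})" using T(1) mono_generate[of "T - {x}" T] by (auto simp: P_def)
    moreover have "card (T - {x}) < card T"
      using x TS assms by (intro card_Diff1_less) (auto intro: finite_subset)
    ultimately show False using T(2) by (meson leD)
  qed
  then show ?thesis using T(1) by (auto simp: P_def)
qed

section \<open>Comparison of the minimum over series with the minimum over generating sets\<close>

theorem theorem4p5:
  fixes G :: "('a, 'b) monoid_scheme" and p n :: nat
  assumes "group G"
    and "finite (carrier G)"
    and "Factorial_Ring.prime p"
    and "order G = p ^ n"
    and "nilpotency_class G \<le> p"
  shows "r_invariant G = ge G"
proof -
  interpret group G by fact
  note p = \<open>Factorial_Ring.prime p\<close>
  let ?lcm = "\<lambda>s Ns. LCM i\<in>{1..s}. group_exp (G\<lparr>carrier := Ns i\<rparr>)"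
  have "lower_central G (nilpotency_class G) = {\<one>\<^bsub>G\<^esub>}"
    unfolding nilpotency_class_def
    by (rule LeastI_ex) (rule prime_power_order_nilpotent[OF p \<open>order G = p ^ n\<close>])
  \<comment> \<open>The lower series decreases, so its term \<open>p\<close> is trivial; in the
    filtration this is index \<open>Suc p\<close>.\<close>
  moreover have "lower_central G p \<subseteq> lower_central G (nilpotency_class G)"
    using lower_central_Suc_subset \<open>nilpotency_class G \<le> p\<close> by (rule lift_Suc_antimono_le)
  moreover have "\<one>\<^bsub>G\<^esub> \<in> lower_central G p"
    using lower_central_normal normal_imp_subgroup subgroup.one_closed by blast
  ultimately have nil: "lower_central G p = {\<one>\<^bsub>G\<^esub>}" by blast
  interpret L: filtered_group G "\<lambda>i. lower_central G (i - 1)" by (rule filtered_group_lower_central)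

  have "generate G (carrier G) = carrier G"
    using generate_incl[of "carrier G"] generate.incl[of _ "carrier G" G] by auto
  then have "\<exists>m S. S \<subseteq> carrier G \<and> generate G S = carrier G \<and> m = Lcm (ord ` S)" by blast
  from LeastI_ex[OF this] obtain S
    where S: "S \<subseteq> carrier G" "generate G S = carrier G" "ge G = Lcm (ord ` S)"
    unfolding ge_def by blast
  \<comment> \<open>Element orders divide the group order, so \<open>ge G\<close> is a power of
    \<open>p\<close>, the form that the exponent lemma requires.\<close>
  have "Lcm (ord ` S) dvd p ^ n"
    using S(1) ord_dvd_group_order \<open>order G = p ^ n\<close> by (intro Lcm_least) auto
  then obtain k where k: "ge G = p ^ k" using S(3) p by (auto simp: divides_primepow_nat)
  obtain T where T: "T \<subseteq> S" "generate G T = carrier G" "\<And>x. x \<in> T \<Longrightarrow> x \<notin> generate G (T - {x})"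
    using exists_irredundant_generators[OF finite_subset[OF S(1) \<open>finite (carrier G)\<close>] S(1)] S(2) by auto
  have "finite T" using T(1) S(1) \<open>finite (carrier G)\<close> by (meson finite_subset)
  then obtain xs where xs: "set xs = T" "distinct xs" using finite_distinct_list by blast
  have series: "nilpotent_supplement_series G (length xs) (series_group xs) (series_normal xs)"
    using supplement_series_of_generators[of xs p] xs T S(1) nil by auto
  have "group_exp (G\<lparr>carrier := series_normal xs i\<rparr>) dvd p ^ k" if i: "i \<in> {1..length xs}" for i
  proof -
    define x where "x = xs ! (i - 1)"
    have "x \<in> T" using i xs(1) nth_mem[of "i - 1" xs] by (auto simp: x_def)
    then have x: "x \<in> carrier G" "ord x dvd p ^ k" using T(1) S(1,3) k by auto
    have "series_group xs (i - 1) \<subseteq> carrier G"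
      unfolding series_group_def using xs(1) T(1) S(1) set_drop_subset[of "i - 1" xs]
      by (intro generate_incl) blast
    \<comment> \<open>The normal closure of \<open>x\<close> in the subgroup lies in its normal
      closure in \<open>G\<close>, so the class drop for \<open>G\<close> itself suffices.\<close>
    then have conj: "(\<lambda>h. h \<otimes>\<^bsub>G\<^esub> x \<otimes>\<^bsub>G\<^esub> inv\<^bsub>G\<^esub> h) ` series_group xs (i - 1) \<subseteq> L.conjugates x"
      unfolding L.conjugates_def by auto
    have conj_carrier: "L.conjugates x \<subseteq> carrier G" using L.conjugates_subset[of x] x(1) by simp
    have "series_normal xs i \<subseteq> generate G (L.conjugates x)"
      unfolding series_normal_def x_def[symmetric] using conj by (rule mono_generate)
    then have pow: "y [^]\<^bsub>G\<^esub> (p ^ k) = \<one>\<^bsub>G\<^esub>" if "y \<in> series_normal xs i" for y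
      using L.exponent_normal_closure[OF p, of x k y] that nil x by (simp add: pow_eq_id subset_iff)
    have sub: "subgroup (series_normal xs i) G"
      unfolding series_normal_def x_def[symmetric]
      using conj conj_carrier by (intro generate_is_subgroup) blast
    have "ord y dvd p ^ k" if "y \<in> series_normal xs i" for y
      using pow[OF that] pow_eq_id[of y "p ^ k"] subgroup.mem_carrier[OF sub that] by simp
    then show ?thesis
      unfolding group_exp_subgroup[OF sub] by (intro Lcm_least) auto
  qed
  then have "?lcm (length xs) (series_normal xs) dvd p ^ k" by (intro Lcm_least) auto
  then have "?lcm (length xs) (series_normal xs) \<le> ge G"
    using k p by (simp add: dvd_imp_le prime_gt_0_nat)
  moreover have "r_invariant G \<le> ?lcm (length xs) (series_normal xs)"
    unfolding r_invariant_def using series by (intro Least_le) blast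
  \<comment> \<open>The series just built shows that the minimum defining \<open>r_invariant\<close>
    is attained.\<close>
  moreover have "\<exists>s Gs Ns. nilpotent_supplement_series G s Gs Ns \<and> r_invariant G = ?lcm s Ns"
    unfolding r_invariant_def
    by (rule LeastI_ex[of "\<lambda>m. \<exists>s Gs Ns. nilpotent_supplement_series G s Gs Ns \<and> m = ?lcm s Ns"])
      (use series in blast)
  then have "ge G \<le> r_invariant G" using ge_le_supplement_series by metis
  ultimately show ?thesis by simp
qed

end
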